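(* Let $d\ge 1$ and let $\mathbb{R}_+=(0,\infty)$. Let $\Lambda_d\subset\mathbb{R}_+^{d+1}$ (respectively $\Lambda_d^+\subset\mathbb{R}_+^{d+1}$) be the set of all degree $d$ real-to-tropical root preservers (respectively of all degree $d$ positive real-to-tropical root preservers) $\{\lambda_{k,d}\}_{0\le k\le d}$. Then $\Lambda_d$ (respectively $\Lambda_d^+$) is a nonempty closed full-dimensional subset of $\mathbb{R}_+^{d+1}$. Moreover, the recession cone of its logarithmic image $\mathrm{Ln}(\Lambda_d)$ (respectively $\mathrm{Ln}(\Lambda_d^+)$) coincides with the cone of all concave sequences of length $d+1$.
   Context: Tropical indices. For a real polynomial $Q(x)=\sum_{k=0}^d b_kx^k$ of degree $d$, an integer $k\in\{0,\dots,d\}$ is a tropical index of $Q$ if there is a real $x_k>0$ with $|b_k|x_k^k\ge\max_{i\ne k}|b_i|x_k^i$. Essential tropical roots. Let $\{\lambda_{k,d}\}_{0\le k\le d}$ be positive numbers and $P(x)=\sum_{k=0}^d a_kx^k$ a real polynomial of degree $d$. The $\lambda$-tropicalization of $P$ is $tr_P^\lambda(\xi)=\max_{0\le k\le d}(k\xi+\ln|a_k|+\ln\lambda_{k,d})$, $\xi\in\mathbb{R}$ (terms with $a_k=0$ are ignored). Its tropical indices $k_0<k_1<\dots<k_m$ are the tropical indices of $\sum_k\lambda_{k,d}a_kx^k$. The number of positive (resp. negative) essential tropical roots of $tr_P^\lambda$ is the number of sign alternations in the sequence $\{\mathrm{sgn}(a_{k_i})\}_{0\le i\le m}$ (resp.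 $\{\mathrm{sgn}((-1)^{k_i}a_{k_i})\}_{0\le i\le m}$). The (total) number of essential tropical roots is the sum of these two numbers. Preservers. A sequence $\{\lambda_{k,d}\}_{0\le k\le d}$ of positive numbers is a degree $d$ real-to-tropical root preserver (resp. degree $d$ positive real-to-tropical root preserver) if for every real polynomial $P$ of degree $d$ (resp. every polynomial $P$ of degree $d$ with positive coefficients), the number of essential tropical roots of $tr_P^\lambda$ is greater than or equal to the number of non-zero real roots of $P$ (counted with multiplicity). For $\Omega\subset\mathbb{R}_+^{k}$, $\mathrm{Ln}(\Omega)\subset\mathbb{R}^k$ is the set obtained by taking natural logarithms of the points of $\Omega$ coordinatewise. The recession cone of $X\subset\mathbb{R}^{d+1}$ is the largest cone $C\subseteq\mathbb{R}^{d+1}$ containing the origin such that $x+c\in X$ for all $x\in X$, $c\in C$. A sequence $(c_0,\dots,c_d)$ is concave if $2c_k\ge c_{k-1}+c_{k+1}$ for $1\le k\le d-1$. *)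

theory Defs
  imports "HOL-Analysis.Analysis" "HOL-Computational_Algebra.Polynomial"
begin

(* A point of R^n is a function x :: nat => real with x i = 0 for all i >= n; this is the carrier of
   the library topology "Euclidean_space n". A sequence of length d + 1, indexed by 0, ..., d,
   is thus a point of "Euclidean_space (Suc d)". *)

definition pos_orthant :: "nat \<Rightarrow> (nat \<Rightarrow> real) set" where
  "pos_orthant n = {x \<in> topspace (Euclidean_space n). \<forall>i<n. 0 < x i}"


definition tropical_index :: "real poly \<Rightarrow> nat \<Rightarrow> bool" where
  "tropical_index Q k \<longleftrightarrow>
     k \<le> degree Q \<and>
     (\<exists>x>0. \<forall>i\<le>degree Q. i \<noteq> k \<longrightarrow> \<bar>coeff Q i\<bar> * x ^ i \<le> \<bar>coeff Q k\<bar> * x ^ k)"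

definition scale_coeffs :: "(nat \<Rightarrow> real) \<Rightarrow> real poly \<Rightarrow> real poly" where
  "scale_coeffs l P = (\<Sum>k\<le>degree P. monom (l k * coeff P k) k)"

(* The increasing list k_0 < ... < k_m of the tropical indices of the l-tropicalization of P. *)
definition trop_indices :: "(nat \<Rightarrow> real) \<Rightarrow> real poly \<Rightarrow> nat list" where
  "trop_indices l P = sorted_list_of_set {k. tropical_index (scale_coeffs l P) k}"

(* Intended for sequences without zero entries: for P of degree d and l positive, the coefficient
   of P at a tropical index never vanishes. *)
definition sign_alternations :: "real list \<Rightarrow> nat" where
  "sign_alternations s = card {i. Suc i < length s \<and> s ! i * s ! Suc i < 0}"

definition pos_essential_roots :: "(nat \<Rightarrow> real) \<Rightarrow> real poly \<Rightarrow> nat" where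
  "pos_essential_roots l P =
     sign_alternations (map (\<lambda>k. sgn (coeff P k)) (trop_indices l P))"

definition neg_essential_roots :: "(nat \<Rightarrow> real) \<Rightarrow> real poly \<Rightarrow> nat" where
  "neg_essential_roots l P =
     sign_alternations (map (\<lambda>k. sgn ((- 1) ^ k * coeff P k)) (trop_indices l P))"

definition essential_roots :: "(nat \<Rightarrow> real) \<Rightarrow> real poly \<Rightarrow> nat" where
  "essential_roots l P = pos_essential_roots l P + neg_essential_roots l P"

(* proots P is the multiset of real roots of P, each occurring with its multiplicity. *)
definition nonzero_real_roots :: "real poly \<Rightarrow> nat" where
  "nonzero_real_roots P = size {#x \<in># proots P. x \<noteq> 0#}"

definition root_preservers :: "nat \<Rightarrow> (nat \<Rightarrow> real) set" where
  "root_preservers d =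
     {l \<in> pos_orthant (Suc d).
        \<forall>P. degree P = d \<longrightarrow> nonzero_real_roots P \<le> essential_roots l P}"

definition pos_root_preservers :: "nat \<Rightarrow> (nat \<Rightarrow> real) set" where
  "pos_root_preservers d =
     {l \<in> pos_orthant (Suc d).
        \<forall>P. degree P = d \<and> (\<forall>k\<le>d. 0 < coeff P k) \<longrightarrow>
          nonzero_real_roots P \<le> essential_roots l P}"


(* Coordinates outside R^n stay 0, independently of the convention for ln 0. *)
definition Ln_image :: "nat \<Rightarrow> (nat \<Rightarrow> real) set \<Rightarrow> (nat \<Rightarrow> real) set" where
  "Ln_image n X = (\<lambda>x i. if i < n then ln (x i) else 0) ` X"

(* The library's cone needs the type class real_vector, which nat => real does not belong to. *)
definition is_cone :: "nat \<Rightarrow> (nat \<Rightarrow> real) set \<Rightarrow> bool" where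
  "is_cone n C \<longleftrightarrow>
     C \<subseteq> topspace (Euclidean_space n) \<and> (\<lambda>i. 0) \<in> C \<and>
     (\<forall>c\<in>C. \<forall>t\<ge>0. (\<lambda>i. t * c i) \<in> C)"

definition recession_cone :: "nat \<Rightarrow> (nat \<Rightarrow> real) set \<Rightarrow> (nat \<Rightarrow> real) set" where
  "recession_cone n X =
     (GREATEST C. is_cone n C \<and> (\<forall>x\<in>X. \<forall>c\<in>C. (\<lambda>i. x i + c i) \<in> X))"

(* The greatest such cone always exists, with respect to inclusion. *)
lemma recession_cone_eq_Union:
  "recession_cone n X =
     \<Union>{C. is_cone n C \<and> (\<forall>x\<in>X. \<forall>c\<in>C. (\<lambda>i. x i + c i) \<in> X)}"
  (is "_ = \<Union>?F")
  unfolding recession_cone_def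
proof (rule Greatest_equality)
  have "{\<lambda>i. 0} \<in> ?F"
    by (auto simp: is_cone_def topspace_Euclidean_space)
  then show "is_cone n (\<Union>?F) \<and> (\<forall>x\<in>X. \<forall>c\<in>\<Union>?F. (\<lambda>i. x i + c i) \<in> X)"
    unfolding is_cone_def by blast
qed blast

definition concave_sequences :: "nat \<Rightarrow> (nat \<Rightarrow> real) set" where
  "concave_sequences d =
     {c \<in> topspace (Euclidean_space (Suc d)).
        \<forall>k. 1 \<le> k \<and> k \<le> d - 1 \<longrightarrow> c (k - 1) + c (k + 1) \<le> 2 * c k}"

(* For a subset of R^n, full-dimensional means having nonempty interior in R^n. *)
definition full_dimensional :: "nat \<Rightarrow> (nat \<Rightarrow> real) set \<Rightarrow> bool" where
  "full_dimensional n X \<longleftrightarrow> Euclidean_space n interior_of X \<noteq> {}"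

end

theory Submission
  imports Defs "HOL-Library.Sublist"
begin

text \<open>
  Both claims are proved for weights that preserve the roots of an arbitrary class of polynomials of
  degree \<open>d\<close> containing \<open>(x + 1) ^ d\<close>.

  Existence of preservers is the heart of the matter. Take the weights \<open>A ^ (- k\<^sup>2)\<close> with \<open>A\<close> large. A monomial
  of \<open>P\<close> whose index is not tropical is then, at every \<open>x > 0\<close>, smaller by the factor \<open>A\<close> than some
  other monomial (\<open>gaussian_weights_dominance\<close>). For such polynomials Descartes' rule of signs holds with
  only the tropical indices taken into account (\<open>positive_roots_le_set_alternations\<close>): apply an operator
  \<open>P \<mapsto> x P' - c P\<close> for each alternation, with \<open>c\<close> a half-integer located at the alternation. By Rolle's
  theorem each operator loses at most one positive root (\<open>positive_roots_euler_op\<close>); together they remove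
  all alternations (\<open>euler_twist_constant_sign\<close>); and they change the sizes of coefficients so little
  that the tropical terms, now all of one sign, still dominate, so no positive root is left. Applying
  this also to \<open>P (- x)\<close> bounds the number of all nonzero roots.

  Multiplying the weights by the exponential of a concave sequence only adds tropical indices
  (\<open>trop_index_set_concave_mono\<close>), and adding indices never lowers the number of alternations. Hence the
  concave sequences lie in the recession cone, and the strictly log-concave multiples of one preserver
  form a nonempty open set of preservers. Being a tropical index is a closed condition on the weights
  (\<open>ex_dominating_point_iff\<close>), which by the same monotonicity makes the set of preservers closed in the
  orthant. Conversely, the \<open>d\<close> real roots of \<open>(x + 1) ^ d\<close> force all of its indices to be tropical
  (\<open>preserver_binomial_log_concave\<close>); this bounds the second differences of the logarithm of a preserver
  from above, so a direction in which they could grow without bound is not in the recession cone.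
\<close>

section \<open>Twisted Euler operators and positive roots\<close>

text \<open>The number of positive real roots, counted with multiplicity.\<close>

definition positive_roots :: "real poly \<Rightarrow> nat" where
  "positive_roots P = size {#x \<in># proots P. 0 < x#}"

lemma positive_roots_eq_sum_order:
  assumes "P \<noteq> 0"
  shows "positive_roots P = (\<Sum>x | 0 < x \<and> poly P x = 0. order x P)"
proof -
  have "set_mset {#x \<in># proots P. 0 < x#} = {x. 0 < x \<and> poly P x = 0}"
    using assms by auto
  then show ?thesis
    using assms by (simp add: positive_roots_def size_multiset_overloaded_eq)
qed

text \<open>The twisted Euler operator \<open>P \<mapsto> x P' - c P\<close>. It multiplies the coefficient of \<open>x ^ k\<close> by \<open>k - c\<close>.\<close>

definition euler_op :: "real \<Rightarrow> real poly \<Rightarrow> real poly" where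
  "euler_op c P = pCons 0 (pderiv P) - smult c P"

lemma coeff_euler_op: "coeff (euler_op c P) k = (real k - c) * coeff P k"
  by (cases k) (simp_all add: euler_op_def coeff_pderiv algebra_simps)

text \<open>A root of multiplicity \<open>m\<close> of \<open>P\<close> has multiplicity at least \<open>m - 1\<close> in \<open>x P' - c P\<close>.\<close>

lemma order_euler_op:
  assumes "euler_op c P \<noteq> 0"
  shows "order r P \<le> Suc (order r (euler_op c P))"
proof (cases "order r P")
  case (Suc n)
  have "P \<noteq> 0"
    using assms by (auto simp: euler_op_def)
  have "[:-r, 1:] ^ n dvd P"
    by (rule dvd_trans[OF le_imp_power_dvd order_1]) (simp add: Suc)
  moreover have "[:-r, 1:] ^ n dvd pderiv P"
    using order_pderiv[OF \<open>P \<noteq> 0\<close>, of r] Suc order_root[of P r] by (simp add: order_divides)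
  then have "[:-r, 1:] ^ n dvd pCons 0 (pderiv P)"
    using dvd_mult[of _ "pderiv P" "[:0, 1:]"] by simp
  ultimately have "[:-r, 1:] ^ n dvd euler_op c P"
    unfolding euler_op_def by (intro dvd_diff dvd_smult)
  then show ?thesis
    using assms Suc by (simp add: order_divides)
qed simp

text \<open>Rolle's theorem for \<open>x powr (- c) * P\<close>, whose derivative is \<open>x powr (- c - 1)\<close> times the
  twisted Euler operator applied to \<open>P\<close>.\<close>

lemma euler_op_root_between:
  assumes "0 < a" "a < b" "poly P a = 0" "poly P b = 0"
  shows "\<exists>z. a < z \<and> z < b \<and> poly (euler_op c P) z = 0"
proof -
  define f where "f x = x powr (- c) * poly P x" for x
  have "\<exists>z. a < z \<and> z < b \<and> (- c) * z powr (- c - 1) * poly P z + poly (pderiv P) z * z powr (- c) = 0"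
  proof -
    have der: "(f has_real_derivative (- c) * x powr (- c - 1) * poly P x + poly (pderiv P) x * x powr (- c)) (at x)"
      if "0 < x" for x
      unfolding f_def using that by (auto intro!: derivative_eq_intros)
    have "continuous_on {a..b} f"
      using assms(1) by (intro DERIV_continuous_on[OF DERIV_subset[OF der]]) auto
    then obtain z where z: "a < z" "z < b" and
      "(\<lambda>v. ((- c) * z powr (- c - 1) * poly P z + poly (pderiv P) z * z powr (- c)) * v) = (\<lambda>v. 0)"
      using Rolle_deriv[OF assms(2), of f "\<lambda>x v. ((- c) * x powr (- c - 1) * poly P x + poly (pderiv P) x * x powr (- c)) * v"]
        der assms by (auto simp: has_field_derivative_def f_def)
    then show ?thesis
      using z by (metis mult.right_neutral)
  qed
  then obtain z where z: "a < z" "z < b"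
    and eq: "(- c) * z powr (- c - 1) * poly P z + poly (pderiv P) z * z powr (- c) = 0"
    by blast
  have "z powr (- c) = z * z powr (- c - 1)"
    using z assms(1) by (simp add: powr_mult_base)
  with eq have "z powr (- c - 1) * poly (euler_op c P) z = 0"
    by (simp add: euler_op_def algebra_simps)
  then show ?thesis
    using z assms(1) by auto
qed

text \<open>Rolle with multiplicities: the \<open>s\<close> distinct positive roots of \<open>P\<close> lose one unit of multiplicity
  each, and the \<open>s - 1\<close> gaps between them contribute new roots.\<close>

lemma positive_roots_euler_op:
  assumes G: "euler_op c P \<noteq> 0"
  shows "positive_roots P \<le> Suc (positive_roots (euler_op c P))"
proof -
  have P: "P \<noteq> 0"
    using G by (auto simp: euler_op_def)
  define S where "S = {x. 0 < x \<and> poly P x = 0}"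
  define T where "T = {x. 0 < x \<and> poly (euler_op c P) x = 0}"
  have fin: "finite S" "finite T"
    using poly_roots_finite[OF P] poly_roots_finite[OF G] by (auto simp: S_def T_def)
  show ?thesis
  proof (cases "S = {}")
    case True
    then show ?thesis
      by (simp add: positive_roots_eq_sum_order[OF P, folded S_def])
  next
    case False
    \<comment> \<open>\<open>nxt r\<close> is the successor of \<open>r\<close> among the positive roots of \<open>P\<close>.\<close>
    define S' where "S' = S - {Max S}"
    define nxt where "nxt r = Min {s \<in> S. r < s}" for r
    have nxt: "nxt r \<in> S" "r < nxt r" "\<And>s. s \<in> S \<Longrightarrow> r < s \<Longrightarrow> nxt r \<le> s" if "r \<in> S'" for r
    proof -
      have "Max S \<in> {s \<in> S. r < s}"
        using that fin False by (auto simp: S'_def order_less_le)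
      then have "nxt r \<in> {s \<in> S. r < s}"
        unfolding nxt_def using fin by (intro Min_in) auto
      then show "nxt r \<in> S" "r < nxt r"
        by auto
      show "nxt r \<le> s" if "s \<in> S" "r < s" for s
        unfolding nxt_def using fin that by (intro Min_le) auto
    qed
    have "\<exists>z. r < z \<and> z < nxt r \<and> poly (euler_op c P) z = 0" if "r \<in> S'" for r
      using that nxt[OF that] by (intro euler_op_root_between) (auto simp: S'_def S_def)
    then obtain g where g: "\<And>r. r \<in> S' \<Longrightarrow> r < g r \<and> g r < nxt r \<and> poly (euler_op c P) (g r) = 0"
      by metis
    have mono: "g r < g r'" if "r \<in> S'" "r' \<in> S'" "r < r'" for r r'
    proof -
      have "nxt r \<le> r'"
        using that by (intro nxt) (auto simp: S'_def)
      then show ?thesis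
        using g[OF that(1)] g[OF that(2)] by linarith
    qed
    have inj: "inj_on g S'"
      by (rule inj_onI) (metis less_irrefl linorder_neqE mono)
    have disj: "g ` S' \<inter> S = {}"
      using g nxt(3) by force
    have gT: "g ` S' \<subseteq> T"
      using g unfolding T_def S'_def S_def by force
    have ordT: "order x (euler_op c P) > 0" if "x \<in> T" for x
      using that G by (simp add: T_def order_gt_0_iff)
    have "card S' = (\<Sum>x\<in>g ` S'. 1)"
      using inj by (simp add: card_image)
    also have "\<dots> \<le> (\<Sum>x\<in>g ` S'. order x (euler_op c P))"
      using ordT gT by (intro sum_mono) (metis One_nat_def Suc_leI subsetD)
    finally have 1: "card S' \<le> (\<Sum>x\<in>g ` S'. order x (euler_op c P))" .
    have 2: "positive_roots P \<le> (\<Sum>x\<in>S. Suc (order x (euler_op c P)))"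
      using P by (auto simp: positive_roots_eq_sum_order S_def intro!: sum_mono order_euler_op[OF G])
    have 3: "(\<Sum>x\<in>S. Suc (order x (euler_op c P))) = (\<Sum>x\<in>S. order x (euler_op c P)) + Suc (card S')"
      using fin False by (simp add: sum.distrib S'_def sum_Suc card_Suc_Diff1[symmetric] del: card_Diff_insert)
    have "(\<Sum>x\<in>S. order x (euler_op c P)) + (\<Sum>x\<in>g ` S'. order x (euler_op c P))
        = (\<Sum>x\<in>S \<union> g ` S'. order x (euler_op c P))"
      using fin disj by (subst sum.union_disjoint) (auto simp: S'_def)
    also have "\<dots> = (\<Sum>x\<in>(S \<union> g ` S') \<inter> T. order x (euler_op c P))"
      using fin gT G by (intro sum.mono_neutral_right) (auto simp: S'_def S_def T_def intro!: order_0I)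
    also have "\<dots> \<le> (\<Sum>x\<in>T. order x (euler_op c P))"
      using fin by (intro sum_mono2) auto
    also have "\<dots> = positive_roots (euler_op c P)"
      using G by (simp add: positive_roots_eq_sum_order T_def)
    finally show ?thesis
      using 1 2 3 by linarith
  qed
qed

section \<open>Sign alternations\<close>

lemma sign_alternations_Nil [simp]: "sign_alternations [] = 0"
  by (simp add: sign_alternations_def)

lemma sign_alternations_single [simp]: "sign_alternations [x] = 0"
  by (simp add: sign_alternations_def)

lemma sign_alternations_Cons_Cons [simp]:
  "sign_alternations (x # y # s) = (if x * y < 0 then 1 else 0) + sign_alternations (y # s)"
proof -
  define A where "A s = {i. Suc i < length s \<and> s ! i * s ! Suc i < 0}" for s :: "real list"
  have "A (x # y # s) = {i. i = 0 \<and> x * y < 0} \<union> Suc ` A (y # s)"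
  proof (rule set_eqI)
    show "i \<in> A (x # y # s) \<longleftrightarrow> i \<in> {i. i = 0 \<and> x * y < 0} \<union> Suc ` A (y # s)" for i
      by (cases i) (auto simp: A_def)
  qed
  moreover have "finite (A (y # s))"
    by (rule finite_subset[of _ "{..<length (y # s)}"]) (auto simp: A_def)
  ultimately have "card (A (x # y # s)) = card {i::nat. i = 0 \<and> x * y < 0} + card (Suc ` A (y # s))"
    by (subst card_Un_disjoint[symmetric]) auto
  also have "{i::nat. i = 0 \<and> x * y < 0} = (if x * y < 0 then {0} else {})"
    by auto
  finally show ?thesis
    by (simp add: sign_alternations_def A_def card_image)
qed

text \<open>Keeping the first entry fixed is what makes the induction over subsequences go through: when an
  entry \<open>y\<close> between \<open>x\<close> and \<open>z\<close> is dropped, an alternation between \<open>x\<close> and \<open>z\<close> forces one between \<open>x\<close>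
  and \<open>y\<close> or between \<open>y\<close> and \<open>z\<close>, because \<open>y\<close> is not zero.\<close>

lemma sign_alternations_Cons_subseq:
  assumes "subseq s t" "x \<noteq> 0" "0 \<notin> set t"
  shows "sign_alternations (x # s) \<le> sign_alternations (x # t)"
  using assms
proof (induction arbitrary: x rule: list_emb.induct)
  case (list_emb_Cons s t y)
  have IH: "sign_alternations (y # s) \<le> sign_alternations (y # t)"
    using list_emb_Cons by simp
  have "y \<noteq> 0"
    using list_emb_Cons.prems by auto
  show ?case
  proof (cases s)
    case (Cons z r)
    have "x * z < 0 \<Longrightarrow> \<not> x * y < 0 \<Longrightarrow> y * z < 0"
      using \<open>x \<noteq> 0\<close> \<open>y \<noteq> 0\<close> by (auto simp: mult_less_0_iff)
    then show ?thesis
      using IH Cons by (auto split: if_splits)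
  qed simp
qed auto

lemma sign_alternations_subseq:
  assumes "subseq s t" "0 \<notin> set t"
  shows "sign_alternations s \<le> sign_alternations t"
  using assms
proof (induction rule: list_emb.induct)
  case (list_emb_Cons s t y)
  then have "sign_alternations s \<le> sign_alternations t"
    by simp
  also have "\<dots> \<le> sign_alternations (y # t)"
    by (cases t) auto
  finally show ?case .
next
  case (list_emb_Cons2 x y s t)
  then show ?case
    by (auto intro: sign_alternations_Cons_subseq)
qed simp

lemma subseq_sorted_list_of_set:
  fixes A B :: "'a::linorder set"
  assumes "A \<subseteq> B" "finite B"
  shows "subseq (sorted_list_of_set A) (sorted_list_of_set B)"
proof -
  have "sorted_list_of_set A = filter (\<lambda>x. x \<in> A) (sorted_list_of_set B)"
    using assms finite_subset[OF assms]
    by (intro sorted_distinct_set_unique) (auto simp: sorted_wrt_filter)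
  then show ?thesis
    by simp
qed

text \<open>The number of sign alternations of \<open>a\<close> along the elements of \<open>I\<close> in increasing order. For infinite
  \<open>I\<close> the list is empty and the value is 0.\<close>

definition set_alternations :: "(nat \<Rightarrow> real) \<Rightarrow> nat set \<Rightarrow> nat" where
  "set_alternations a I = sign_alternations (map (\<lambda>k. sgn (a k)) (sorted_list_of_set I))"

lemma set_alternations_mono:
  assumes "I \<subseteq> J" "finite J" "\<And>k. k \<in> J \<Longrightarrow> a k \<noteq> 0"
  shows "set_alternations a I \<le> set_alternations a J"
  unfolding set_alternations_def
  using assms by (intro sign_alternations_subseq subseq_map subseq_sorted_list_of_set) (auto simp: sgn_eq_0_iff)

lemma sign_alternations_less_length: "s \<noteq> [] \<Longrightarrow> sign_alternations s < length s"
proof (induction s)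
  case (Cons x s)
  then show ?case
    by (cases s) auto
qed simp

lemma set_alternations_eq_0:
  assumes "finite I" "\<And>k. k \<in> I \<Longrightarrow> 0 < a k"
  shows "set_alternations a I = 0"
proof -
  have *: "sign_alternations s = 0" if "\<And>x. x \<in> set s \<Longrightarrow> 0 < x" for s
  proof -
    have "\<not> s ! i * s ! Suc i < 0" if "Suc i < length s" for i
      using \<open>\<And>x. x \<in> set s \<Longrightarrow> 0 < x\<close>[OF nth_mem] that by (auto simp: mult_less_0_iff not_less less_imp_le)
    then have "{i. Suc i < length s \<and> s ! i * s ! Suc i < 0} = {}"
      by blast
    then show ?thesis
      by (simp only: sign_alternations_def card.empty)
  qed
  then show ?thesis
    unfolding set_alternations_def using assms by (intro *) (auto simp: sgn_pos)
qed

text \<open>One twist by \<open>k - (m + 1/2)\<close> for every index \<open>m\<close> that is followed by an alternation removes all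
  alternations: the factor changes sign exactly between \<open>m\<close> and its successor in \<open>I\<close>, and it never
  vanishes at an integer.\<close>

lemma euler_twist_constant_sign:
  assumes I: "finite I" and nz: "\<And>k. k \<in> I \<Longrightarrow> a k \<noteq> 0"
  obtains M :: "nat set" where "M \<subseteq> I" "card M = set_alternations a I"
    "\<And>k l. k \<in> I \<Longrightarrow> l \<in> I \<Longrightarrow>
       0 < ((\<Prod>m\<in>M. real k - (real m + 1/2)) * a k) * ((\<Prod>m\<in>M. real l - (real m + 1/2)) * a l)"
proof -
  define ks where "ks = sorted_list_of_set I"
  have ks: "sorted_wrt (<) ks" "set ks = I" "distinct ks"
    using I by (auto simp: ks_def)
  define A where "A = {i. Suc i < length ks \<and> a (ks ! i) * a (ks ! Suc i) < 0}"
  define M where "M = (!) ks ` A"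
  define b where "b k = (\<Prod>m\<in>M. real k - (real m + 1/2)) * a k" for k
  have finA: "finite A"
    by (rule finite_subset[of _ "{..<length ks}"]) (auto simp: A_def)
  have inj: "inj_on ((!) ks) A"
    using ks(3) by (auto simp: inj_on_def A_def nth_eq_iff_index_eq)
  have card: "card M = set_alternations a I"
    using inj unfolding M_def set_alternations_def ks_def[symmetric] sign_alternations_def
    by (auto simp: card_image A_def sgn_mult[symmetric] intro!: arg_cong[of _ _ card])
  have sub: "M \<subseteq> I"
    using ks(2) by (auto simp: M_def A_def)
  have step: "0 < b (ks ! t) * b (ks ! Suc t)" if t: "Suc t < length ks" for t
  proof -
    have less: "ks ! i < ks ! j" if "i < j" "j < length ks" for i j
      using sorted_wrt_nth_less[OF ks(1)] that by blast
    have fac: "(real (ks ! t) - (real (ks ! i) + 1/2)) * (real (ks ! Suc t) - (real (ks ! i) + 1/2)) < 0 \<longleftrightarrow> i = t"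
         "(real (ks ! t) - (real (ks ! i) + 1/2)) * (real (ks ! Suc t) - (real (ks ! i) + 1/2)) \<noteq> 0"
      if "i < length ks" for i
    proof -
      let ?u = "real (ks ! t) - (real (ks ! i) + 1/2)" and ?v = "real (ks ! Suc t) - (real (ks ! i) + 1/2)"
      consider "i < t" | "i = t" | "t < i" by linarith
      then have "(?u * ?v < 0 \<longleftrightarrow> i = t) \<and> ?u * ?v \<noteq> 0"
      proof cases
        case 1
        then have "0 < ?u" "0 < ?v"
          using less[of i t] less[of t "Suc t"] t by auto
        with 1 show "(?u * ?v < 0 \<longleftrightarrow> i = t) \<and> ?u * ?v \<noteq> 0"
          by (auto simp: mult_less_0_iff)
      next
        case 2
        then have "?u < 0" "0 < ?v"
          using less[of t "Suc t"] t by auto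
        with 2 show "(?u * ?v < 0 \<longleftrightarrow> i = t) \<and> ?u * ?v \<noteq> 0"
          by (auto simp: mult_less_0_iff)
      next
        case 3
        then have "ks ! Suc t \<le> ks ! i"
          using less[of "Suc t" i] that by (cases "i = Suc t") auto
        then have "?u < 0" "?v < 0"
          using less[of t "Suc t"] t by auto
        with 3 show "(?u * ?v < 0 \<longleftrightarrow> i = t) \<and> ?u * ?v \<noteq> 0"
          by (auto simp: mult_less_0_iff)
      qed
      then show "?u * ?v < 0 \<longleftrightarrow> i = t" "?u * ?v \<noteq> 0"
        by blast+
    qed
    define g where "g i = (real (ks ! t) - (real (ks ! i) + 1/2)) * (real (ks ! Suc t) - (real (ks ! i) + 1/2))" for i
    have eq: "b (ks ! t) * b (ks ! Suc t) = (\<Prod>i\<in>A. g i) * (a (ks ! t) * a (ks ! Suc t))"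
      unfolding b_def M_def prod.reindex[OF inj] g_def prod.distrib by (simp add: algebra_simps)
    have pos: "0 < (\<Prod>i\<in>A - {t}. g i)"
    proof (intro prod_pos)
      fix i assume "i \<in> A - {t}"
      then have "i < length ks" "i \<noteq> t"
        by (auto simp: A_def)
      then have "\<not> g i < 0" "g i \<noteq> 0"
        using fac[of i] unfolding g_def by blast+
      then show "0 < g i"
        by linarith
    qed
    have "a (ks ! t) \<noteq> 0" "a (ks ! Suc t) \<noteq> 0"
      using nz ks(2) t by (metis Suc_lessD nth_mem)+
    then have nz': "a (ks ! t) * a (ks ! Suc t) \<noteq> 0"
      by simp
    show "0 < b (ks ! t) * b (ks ! Suc t)"
    proof (cases "t \<in> A")
      case True
      then have "(\<Prod>i\<in>A. g i) = g t * (\<Prod>i\<in>A - {t}. g i)"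
        using finA by (simp add: prod.remove)
      moreover have "g t < 0"
        using fac(1)[of t] t by (simp add: g_def)
      moreover have "a (ks ! t) * a (ks ! Suc t) < 0"
        using True by (simp add: A_def)
      ultimately show ?thesis
        using pos eq by (simp add: zero_less_mult_iff mult_less_0_iff)
    next
      case False
      then have "0 < a (ks ! t) * a (ks ! Suc t)"
        using nz' t by (auto simp: A_def not_less order_less_le)
      then show ?thesis
        using pos False eq by simp
    qed
  qed
  have sgn_const: "0 < b (ks ! 0) * b (ks ! t)" if "t < length ks" for t
    using that
  proof (induction t)
    case 0
    show ?case
    proof (cases "Suc 0 < length ks")
      case True
      then show ?thesis
        using step[of 0] by (auto simp: zero_less_mult_iff)
    next
      case False
      then have "A = {}"
        by (auto simp: A_def)
      moreover have "a (ks ! 0) \<noteq> 0"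
        using nz ks(2) 0 by (metis nth_mem)
      ultimately show ?thesis
        by (auto simp: b_def M_def zero_less_mult_iff)
    qed
  next
    case (Suc t)
    then show ?case
      using step[of t] by (auto simp: zero_less_mult_iff)
  qed
  have "0 < b k * b l" if kl: "k \<in> I" "l \<in> I" for k l
  proof -
    have "\<exists>i<length ks. ks ! i = k" "\<exists>j<length ks. ks ! j = l"
      using kl ks(2) by (auto simp: in_set_conv_nth[symmetric])
    then have "0 < b (ks ! 0) * b k" "0 < b (ks ! 0) * b l"
      using sgn_const by blast+
    then show ?thesis
      by (auto simp: zero_less_mult_iff)
  qed
  then show ?thesis
    using sub card that[of M] unfolding b_def by presburger
qed

section \<open>Descartes' rule relative to a set of dominating indices\<close>

lemma iterated_euler_op:
  assumes "finite M" "P \<noteq> 0"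
  shows "\<exists>Q. (\<forall>k. coeff Q k = (\<Prod>m\<in>M. real k - (real m + 1/2)) * coeff P k) \<and>
             positive_roots P \<le> card M + positive_roots Q"
  using assms(1)
proof (induction M)
  case empty
  show ?case by (intro exI[of _ P]) simp
next
  case (insert n M)
  then obtain Q where Q: "\<And>k. coeff Q k = (\<Prod>m\<in>M. real k - (real m + 1/2)) * coeff P k"
    "positive_roots P \<le> card M + positive_roots Q"
    by blast
  let ?G = "euler_op (real n + 1/2) Q"
  have half: "real k - (real m + 1/2) \<noteq> 0" for k m
  proof
    assume "real k - (real m + 1/2) = 0"
    then have "real (2 * k) = real (2 * m + 1)"
      by simp
    then have "2 * k = 2 * m + 1"
      by (simp only: of_nat_eq_iff)
    then show False
      by presburger
  qed
  have "coeff ?G (degree P) \<noteq> 0"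
    using half \<open>P \<noteq> 0\<close> insert.hyps(1) by (simp add: coeff_euler_op Q(1) del: of_nat_add)
  then have "?G \<noteq> 0"
    by auto
  then have "positive_roots Q \<le> Suc (positive_roots ?G)"
    by (rule positive_roots_euler_op)
  then show ?case
    using insert.hyps Q by (intro exI[of _ ?G]) (auto simp: coeff_euler_op)
qed

text \<open>The factor by which the other coefficients have to be dominated for Descartes' rule to hold relative
  to a set of indices. In degree \<open>d\<close>, a product of at most \<open>d + 1\<close> twists changes the ratio of two
  coefficients by at most \<open>(2 * (d + 1)) ^ (d + 1)\<close>; the remaining factor exceeds the number of
  coefficients.\<close>

definition dominance :: "nat \<Rightarrow> real" where
  "dominance d = (real d + 2) * (2 * (real d + 1)) ^ (d + 1)"

lemma dominance_gt_1: "1 < dominance d"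
proof -
  have "(1::real) \<le> (2 * (real d + 1)) ^ (d + 1)"
    by (rule one_le_power) simp
  then have "(real d + 2) * 1 \<le> dominance d"
    unfolding dominance_def by (intro mult_left_mono) auto
  then show ?thesis
    by simp
qed

lemma poly_eq_sum_atMost:
  fixes P :: "real poly"
  assumes "degree P \<le> d"
  shows "poly P x = (\<Sum>k\<le>d. coeff P k * x ^ k)"
  unfolding poly_altdef using assms
  by (intro sum.mono_neutral_left) (auto simp: coeff_eq_0)

lemma half_integer_prod_bounds:
  assumes M: "M \<subseteq> {..d}" and k: "k \<le> d"
  shows "(1/2) ^ (d + 1) \<le> \<bar>\<Prod>m\<in>M. real k - (real m + 1/2)\<bar>"
    and "\<bar>\<Prod>m\<in>M. real k - (real m + 1/2)\<bar> \<le> (real d + 1) ^ (d + 1)"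
proof -
  have fin: "finite M"
    using M finite_subset by blast
  have card: "card M \<le> d + 1"
    using card_mono[OF _ M] by simp
  have lower: "1/2 \<le> \<bar>real k - (real m + 1/2)\<bar>" for m
    by (cases "k \<le> m") auto
  have "(1/2) ^ (d + 1) \<le> (1/2 :: real) ^ card M"
    using card by (intro power_decreasing) auto
  also have "\<dots> = (\<Prod>m\<in>M. 1/2)"
    by simp
  also have "\<dots> \<le> (\<Prod>m\<in>M. \<bar>real k - (real m + 1/2)\<bar>)"
    using lower by (intro prod_mono) auto
  finally show "(1/2) ^ (d + 1) \<le> \<bar>\<Prod>m\<in>M. real k - (real m + 1/2)\<bar>"
    by (simp add: abs_prod)
  have "(\<Prod>m\<in>M. \<bar>real k - (real m + 1/2)\<bar>) \<le> (\<Prod>m\<in>M. real d + 1)"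
  proof (intro prod_mono conjI)
    fix m assume "m \<in> M"
    then have "m \<le> d" using M by auto
    then show "\<bar>real k - (real m + 1/2)\<bar> \<le> real d + 1"
      using k by linarith
  qed simp
  also have "\<dots> = (real d + 1) ^ card M"
    by simp
  also have "\<dots> \<le> (real d + 1) ^ (d + 1)"
    using card by (intro power_increasing) auto
  finally show "\<bar>\<Prod>m\<in>M. real k - (real m + 1/2)\<bar> \<le> (real d + 1) ^ (d + 1)"
    by (simp add: abs_prod)
qed

text \<open>Only the indices in \<open>I\<close> count for Descartes' rule if at every \<open>x > 0\<close> each other monomial is smaller
  than some monomial by the factor \<open>dominance d\<close>. After one twist for each alternation in \<open>I\<close>,
  the terms with index in \<open>I\<close> all have the same sign, and they still outweigh the rest.\<close>

lemma positive_roots_le_set_alternations: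
  assumes deg: "degree P = d" and P: "P \<noteq> 0" and I: "I \<subseteq> {..d}"
    and nz: "\<And>k. k \<in> I \<Longrightarrow> coeff P k \<noteq> 0"
    and dom: "\<And>k x. k \<le> d \<Longrightarrow> k \<notin> I \<Longrightarrow> 0 < x \<Longrightarrow>
       \<exists>i\<le>d. dominance d * (\<bar>coeff P k\<bar> * x ^ k) \<le> \<bar>coeff P i\<bar> * x ^ i"
  shows "positive_roots P \<le> set_alternations (coeff P) I"
proof -
  have "finite I"
    using I finite_subset by blast
  then obtain M where M: "M \<subseteq> I" "card M = set_alternations (coeff P) I"
    and same: "\<And>k l. k \<in> I \<Longrightarrow> l \<in> I \<Longrightarrow>
       0 < ((\<Prod>m\<in>M. real k - (real m + 1/2)) * coeff P k) * ((\<Prod>m\<in>M. real l - (real m + 1/2)) * coeff P l)"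
    using euler_twist_constant_sign[of I "coeff P"] nz by blast
  define p where "p k = (\<Prod>m\<in>M. real k - (real m + 1/2))" for k
  obtain Q where Q: "\<And>k. coeff Q k = p k * coeff P k"
    and le: "positive_roots P \<le> card M + positive_roots Q"
    using iterated_euler_op[OF finite_subset[OF M(1) \<open>finite I\<close>] P] unfolding p_def by blast
  note bounds = half_integer_prod_bounds[OF subset_trans[OF M(1) I], folded p_def]
  have "0 < (1/2 :: real) ^ (d + 1)"
    by simp
  then have "p d \<noteq> 0"
    using bounds(1)[of d] by linarith
  then have "coeff Q d \<noteq> 0"
    using P deg by (auto simp: Q)
  then have "Q \<noteq> 0"
    by auto
  have degQ: "degree Q \<le> d"
    by (rule degree_le) (simp add: Q coeff_eq_0 deg)
  have "poly Q x \<noteq> 0" if x: "0 < x" for x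
  proof -
    define t where "t k = \<bar>coeff P k\<bar> * x ^ k" for k
    have "Max (t ` {..d}) \<in> t ` {..d}"
      by (rule Max_in) auto
    then obtain i where i: "i \<le> d" and "t i = Max (t ` {..d})"
      by (metis imageE atMost_iff)
    then have max: "t k \<le> t i" if "k \<le> d" for k
      using that by simp
    have "0 < t d"
      using P deg x by (auto simp: t_def)
    then have pos: "0 < t i"
      using max[of d] by simp
    have small: "dominance d * t k \<le> t i" if "k \<le> d" "k \<notin> I" for k
      using dom[OF that x] max unfolding t_def[symmetric] by force
    \<comment> \<open>A monomial of largest absolute value at \<open>x\<close> cannot be dominated, so its index lies in \<open>I\<close>.\<close>
    have "i \<in> I"
    proof (rule ccontr)
      assume "i \<notin> I"
      then have "dominance d * t i \<le> 1 * t i"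
        using small i by simp
      then show False
        using pos dominance_gt_1[of d] mult_le_cancel_right_pos[of "t i" "dominance d" 1] by linarith
    qed
    define \<sigma> where "\<sigma> = sgn (coeff Q i)"
    define N where "N = {..d} - I"
    have "coeff Q i \<noteq> 0"
      using same[OF \<open>i \<in> I\<close> \<open>i \<in> I\<close>] by (auto simp: Q p_def)
    have "t i * (1/2) ^ (d + 1) \<le> t i * \<bar>p i\<bar>"
      using pos i bounds(1)[of i] by (intro mult_left_mono) auto
    also have "\<dots> = \<sigma> * coeff Q i * x ^ i"
    proof -
      have "\<sigma> * coeff Q i = \<bar>p i\<bar> * \<bar>coeff P i\<bar>"
        unfolding abs_mult[symmetric] by (simp add: \<sigma>_def Q abs_sgn mult.commute)
      then show ?thesis
        by (simp add: t_def mult_ac)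
    qed
    finally have big: "t i * (1/2) ^ (d + 1) \<le> \<sigma> * coeff Q i * x ^ i" .
    have nonneg: "0 \<le> \<sigma> * coeff Q k * x ^ k" if "k \<in> I" for k
    proof -
      have "0 < coeff Q i * coeff Q k"
        using same[OF \<open>i \<in> I\<close> that] by (simp add: Q p_def)
      then have "0 < \<sigma> * coeff Q k"
        by (auto simp: \<sigma>_def zero_less_mult_iff)
      then show ?thesis
        using x by simp
    qed
    have rest: "- (t i * (real d + 1) ^ (d + 1) / dominance d) \<le> \<sigma> * coeff Q k * x ^ k" if "k \<in> N" for k
    proof -
      have "\<bar>\<sigma> * coeff Q k * x ^ k\<bar> = \<bar>p k\<bar> * t k"
        using x \<open>coeff Q i \<noteq> 0\<close> by (simp add: \<sigma>_def t_def Q abs_mult abs_sgn_eq)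
      also have "\<dots> \<le> (real d + 1) ^ (d + 1) * (t i / dominance d)"
        using that x bounds(2)[of k] small[of k] dominance_gt_1[of d]
        by (intro mult_mono) (auto simp: N_def t_def pos_le_divide_eq mult.commute)
      finally show ?thesis
        by (simp add: mult.commute)
    qed
    have "card N \<le> d + 1"
      using card_mono[of "{..d}" N] by (auto simp: N_def)
    then have cardN: "real (card N) \<le> real d + 1"
      by linarith
    have "\<sigma> * poly Q x = (\<Sum>k\<le>d. \<sigma> * coeff Q k * x ^ k)"
      by (simp add: poly_eq_sum_atMost[OF degQ] sum_distrib_left mult.assoc)
    also have "\<dots> = (\<Sum>k\<in>N. \<sigma> * coeff Q k * x ^ k) + (\<Sum>k\<in>I. \<sigma> * coeff Q k * x ^ k)"
      unfolding N_def using I by (intro sum.subset_diff) auto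
    finally have eq: "\<sigma> * poly Q x = \<dots>" .
    have sumI: "\<sigma> * coeff Q i * x ^ i \<le> (\<Sum>k\<in>I. \<sigma> * coeff Q k * x ^ k)"
      using \<open>finite I\<close> \<open>i \<in> I\<close> nonneg by (intro member_le_sum) auto
    have sumN: "(\<Sum>k\<in>N. - (t i * (real d + 1) ^ (d + 1) / dominance d)) \<le> (\<Sum>k\<in>N. \<sigma> * coeff Q k * x ^ k)"
      by (intro sum_mono rest)
    have "- (real (card N) * (t i * (real d + 1) ^ (d + 1) / dominance d)) =
        (\<Sum>k\<in>N. - (t i * (real d + 1) ^ (d + 1) / dominance d))"
      by simp
    then have 1: "- (real (card N) * (t i * (real d + 1) ^ (d + 1) / dominance d)) + t i * (1/2) ^ (d + 1)
        \<le> \<sigma> * poly Q x"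
      using eq sumI sumN big by linarith
    have 2: "real (card N) * (t i * (real d + 1) ^ (d + 1) / dominance d) < t i * (1/2) ^ (d + 1)"
    proof -
      have "real (card N) * (t i * (real d + 1) ^ (d + 1) / dominance d)
          \<le> (real d + 1) * (t i * (real d + 1) ^ (d + 1) / dominance d)"
        using cardN pos dominance_gt_1[of d] by (intro mult_right_mono) auto
      also have "\<dots> < (real d + 2) * (t i * (real d + 1) ^ (d + 1) / dominance d)"
        using pos dominance_gt_1[of d] by (intro mult_strict_right_mono) auto
      also have "\<dots> = t i * (1/2) ^ (d + 1)"
        unfolding dominance_def power_mult_distrib
        by (simp add: power_divide divide_simps del: power_Suc)
      finally show ?thesis .
    qed
    from 1 2 have "0 < \<sigma> * poly Q x"
      by linarith
    then show ?thesis
      by auto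
  qed
  then have "{x. 0 < x \<and> poly Q x = 0} = {}"
    by auto
  then have "positive_roots Q = 0"
    by (simp only: positive_roots_eq_sum_order[OF \<open>Q \<noteq> 0\<close>] sum.empty)
  then show ?thesis
    using le M(2) by simp
qed

section \<open>Tropical indices\<close>

text \<open>The set of tropical indices of the tropicalization of \<open>P\<close> with weights \<open>l\<close>.\<close>

definition trop_index_set :: "(nat \<Rightarrow> real) \<Rightarrow> real poly \<Rightarrow> nat set" where
  "trop_index_set l P = {k. tropical_index (scale_coeffs l P) k}"

lemma essential_roots_eq_set_alternations:
  "essential_roots l P = set_alternations (coeff P) (trop_index_set l P) +
     set_alternations (\<lambda>k. (- 1) ^ k * coeff P k) (trop_index_set l P)"
  by (simp add: essential_roots_def pos_essential_roots_def neg_essential_roots_def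
      set_alternations_def trop_indices_def trop_index_set_def)

text \<open>No bound on \<open>k\<close> is needed: above the degree both sides are 0.\<close>

lemma coeff_scale_coeffs: "coeff (scale_coeffs l P) k = l k * coeff P k"
  by (simp add: scale_coeffs_def coeff_sum coeff_monom coeff_eq_0 if_distrib[of "\<lambda>c. _ * c"] cong: if_cong)

lemma degree_scale_coeffs:
  assumes "l (degree P) \<noteq> 0"
  shows "degree (scale_coeffs l P) = degree P"
proof (cases "P = 0")
  case False
  have "degree (scale_coeffs l P) \<le> degree P"
    by (rule degree_le) (simp add: coeff_scale_coeffs coeff_eq_0)
  moreover have "degree P \<le> degree (scale_coeffs l P)"
    using assms False by (intro le_degree) (simp add: coeff_scale_coeffs)
  ultimately show ?thesis
    by simp
qed (simp add: scale_coeffs_def)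

lemma mem_trop_index_set_iff:
  assumes "degree P = d" "\<forall>k\<le>d. 0 < l k"
  shows "k \<in> trop_index_set l P \<longleftrightarrow>
    k \<le> d \<and> (\<exists>x>0. \<forall>i\<le>d. l i * \<bar>coeff P i\<bar> * x ^ i \<le> l k * \<bar>coeff P k\<bar> * x ^ k)"
proof -
  have "degree (scale_coeffs l P) = d"
    using degree_scale_coeffs[of l P] assms by force
  moreover have "\<bar>l i * coeff P i\<bar> = l i * \<bar>coeff P i\<bar>" if "i \<le> d" for i
    using assms(2) that by (simp add: abs_mult abs_of_pos)
  ultimately show ?thesis
    unfolding trop_index_set_def tropical_index_def coeff_scale_coeffs by fastforce
qed

lemma trop_index_set_subset:
  assumes "degree P = d" "\<forall>k\<le>d. 0 < l k"
  shows "trop_index_set l P \<subseteq> {..d}"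
  using mem_trop_index_set_iff[OF assms] by auto

lemma coeff_trop_index_nonzero:
  assumes "degree P = d" "\<forall>k\<le>d. 0 < l k" "P \<noteq> 0" "k \<in> trop_index_set l P"
  shows "coeff P k \<noteq> 0"
proof
  assume 0: "coeff P k = 0"
  obtain x where "0 < x" "l d * \<bar>coeff P d\<bar> * x ^ d \<le> l k * \<bar>coeff P k\<bar> * x ^ k"
    using assms(4) unfolding mem_trop_index_set_iff[OF assms(1,2)] by auto
  moreover have "0 < \<bar>coeff P d\<bar>"
    using assms by auto
  ultimately have "l d * \<bar>coeff P d\<bar> * x ^ d \<le> 0" "0 < l d * \<bar>coeff P d\<bar> * x ^ d"
    using 0 assms(2) by auto
  then show False
    by simp
qed

lemma set_alternations_trop_index_mono:
  assumes "degree P = d" "P \<noteq> 0" "\<forall>k\<le>d. 0 < l k"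
    and "I \<subseteq> trop_index_set l P"
  shows "set_alternations (coeff P) I + set_alternations (\<lambda>k. (- 1) ^ k * coeff P k) I \<le> essential_roots l P"
  unfolding essential_roots_eq_set_alternations
  using assms finite_subset[OF trop_index_set_subset[of P d l]] coeff_trop_index_nonzero[of P d l]
  by (intro add_mono set_alternations_mono) auto

text \<open>A concave sequence lies below a line through any of its points.\<close>

lemma supporting_slope:
  fixes c :: "nat \<Rightarrow> real"
  assumes concave: "\<And>k. 1 \<le> k \<Longrightarrow> k \<le> d - 1 \<Longrightarrow> c (k - 1) + c (k + 1) \<le> 2 * c k"
    and "k \<le> d"
  obtains s where "\<And>i. i \<le> d \<Longrightarrow> c i \<le> c k + s * (real i - real k)"
proof -
  define \<delta> where "\<delta> m = c (Suc m) - c m" for m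
  have \<delta>: "\<delta> n \<le> \<delta> m" if "m \<le> n" "n < d" for m n
    using that
  proof (induction rule: dec_induct)
    case (step n)
    then have "1 \<le> Suc n" "Suc n \<le> d - 1"
      by auto
    then have "\<delta> (Suc n) \<le> \<delta> n"
      using concave[of "Suc n"] by (simp add: \<delta>_def)
    with step show ?case
      by simp
  qed simp
  define s where "s = (if k < d then \<delta> k else \<delta> (d - 1))"
  have right: "c (k + j) \<le> c k + s * real j" if "k + j \<le> d" for j
    using that
  proof (induction j)
    case (Suc j)
    then have "\<delta> (k + j) \<le> s"
      using \<delta>[of k "k + j"] by (auto simp: s_def)
    with Suc show ?case
      by (simp add: \<delta>_def algebra_simps)
  qed simp
  have left: "c (k - j) \<le> c k - s * real j" if "j \<le> k" for j
    using that
  proof (induction j)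
    case (Suc j)
    then have "s \<le> \<delta> (k - Suc j)"
      using \<delta>[of "k - Suc j" k] \<delta>[of "k - Suc j" "d - 1"] \<open>k \<le> d\<close> by (auto simp: s_def)
    with Suc show ?case
      by (simp add: \<delta>_def algebra_simps Suc_diff_Suc)
  qed simp
  have "c i \<le> c k + s * (real i - real k)" if "i \<le> d" for i
  proof (cases "k \<le> i")
    case True
    then show ?thesis
      using right[of "i - k"] that by (simp add: of_nat_diff)
  next
    case False
    then show ?thesis
      using left[of "k - i"] by (simp add: of_nat_diff algebra_simps)
  qed
  then show ?thesis
    by (rule that)
qed

text \<open>Multiplying the weights by the exponential of a concave sequence only creates tropical indices: if
  \<open>s\<close> is a supporting slope at \<open>k\<close> and the monomial \<open>k\<close> dominates at \<open>x\<close>, then it dominates at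
  \<open>x * exp (- s)\<close> for the new weights.\<close>

lemma trop_index_set_concave_mono:
  assumes deg: "degree P = d" and l: "\<forall>k\<le>d. 0 < l k"
    and concave: "\<And>k. 1 \<le> k \<Longrightarrow> k \<le> d - 1 \<Longrightarrow> c (k - 1) + c (k + 1) \<le> 2 * c k"
    and m: "\<And>k. k \<le> d \<Longrightarrow> m k = l k * exp (c k)"
  shows "trop_index_set l P \<subseteq> trop_index_set m P"
proof
  fix k assume k: "k \<in> trop_index_set l P"
  then obtain x where "k \<le> d" "0 < x"
    and x: "\<And>i. i \<le> d \<Longrightarrow> l i * \<bar>coeff P i\<bar> * x ^ i \<le> l k * \<bar>coeff P k\<bar> * x ^ k"
    unfolding mem_trop_index_set_iff[OF deg l] by auto
  obtain s where s: "\<And>i. i \<le> d \<Longrightarrow> c i \<le> c k + s * (real i - real k)"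
    using supporting_slope[OF concave \<open>k \<le> d\<close>] by blast
  have pow: "(x * exp (- s)) ^ i = x ^ i * exp (- (s * real i))" for i
    by (simp add: power_mult_distrib exp_of_nat_mult[symmetric] mult.commute)
  have "m i * \<bar>coeff P i\<bar> * (x * exp (- s)) ^ i \<le> m k * \<bar>coeff P k\<bar> * (x * exp (- s)) ^ k" if "i \<le> d" for i
  proof -
    have "m i * \<bar>coeff P i\<bar> * (x * exp (- s)) ^ i = (l i * \<bar>coeff P i\<bar> * x ^ i) * exp (c i - s * real i)"
      unfolding m[OF that] pow diff_conv_add_uminus exp_add by (simp add: mult_ac)
    also have "\<dots> \<le> (l k * \<bar>coeff P k\<bar> * x ^ k) * exp (c k - s * real k)"
      using s[OF that] l \<open>k \<le> d\<close> \<open>0 < x\<close>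
      by (intro mult_mono[OF x[OF that]]) (auto simp: algebra_simps)
    also have "\<dots> = m k * \<bar>coeff P k\<bar> * (x * exp (- s)) ^ k"
      unfolding m[OF \<open>k \<le> d\<close>] pow diff_conv_add_uminus exp_add by (simp add: mult_ac)
    finally show ?thesis .
  qed
  moreover have "0 < x * exp (- s)"
    using \<open>0 < x\<close> by simp
  moreover have "\<forall>k\<le>d. 0 < m k"
    using l m by simp
  ultimately show "k \<in> trop_index_set m P"
    using \<open>k \<le> d\<close> mem_trop_index_set_iff[OF deg, of m] by blast
qed

lemma ex_between_finite_sets:
  fixes L U :: "real set"
  assumes "finite L" "finite U" "\<And>u. u \<in> U \<Longrightarrow> 0 < u" "\<And>l u. l \<in> L \<Longrightarrow> u \<in> U \<Longrightarrow> l \<le> u"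
  shows "\<exists>x>0. (\<forall>l\<in>L. l \<le> x) \<and> (\<forall>u\<in>U. x \<le> u)"
proof (cases "U = {}")
  case True
  then show ?thesis
    using assms(1) by (intro exI[of _ "Max (insert 1 L)"]) (auto intro: less_le_trans[OF zero_less_one])
next
  case False
  then show ?thesis
    using assms by (intro exI[of _ "Min U"]) auto
qed

text \<open>Elimination of the point \<open>x\<close> from the definition of a tropical index. Each \<open>i < k\<close> gives a lower bound
  for \<open>x\<close> and each \<open>j > k\<close> with \<open>c j > 0\<close> an upper bound; the inequalities on the right say that
  every lower bound is at most every upper bound. Unlike the left-hand side, they are visibly a closed condition on \<open>c\<close>.\<close>

lemma ex_dominating_point_iff:
  fixes c :: "nat \<Rightarrow> real"
  assumes nonneg: "\<And>i. i \<le> d \<Longrightarrow> 0 \<le> c i" and k: "k \<le> d" "0 < c k"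
  shows "(\<exists>x>0. \<forall>i\<le>d. c i * x ^ i \<le> c k * x ^ k) \<longleftrightarrow>
    (\<forall>i j. i < k \<longrightarrow> k < j \<longrightarrow> j \<le> d \<longrightarrow> c i ^ (j - k) * c j ^ (k - i) \<le> c k ^ (j - i))"
proof
  assume "\<exists>x>0. \<forall>i\<le>d. c i * x ^ i \<le> c k * x ^ k"
  then obtain x where x: "0 < x" "\<And>i. i \<le> d \<Longrightarrow> c i * x ^ i \<le> c k * x ^ k"
    by blast
  show "\<forall>i j. i < k \<longrightarrow> k < j \<longrightarrow> j \<le> d \<longrightarrow> c i ^ (j - k) * c j ^ (k - i) \<le> c k ^ (j - i)"
  proof (intro allI impI)
    fix i j assume ij: "i < k" "k < j" "j \<le> d"
    have exps: "i * (j - k) + j * (k - i) = k * (j - i)" "(j - k) + (k - i) = j - i"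
      using ij by (auto simp: diff_mult_distrib2 diff_mult_distrib less_imp_le mult.commute)
    have "(c i * x ^ i) ^ (j - k) * (c j * x ^ j) ^ (k - i)
        \<le> (c k * x ^ k) ^ (j - k) * (c k * x ^ k) ^ (k - i)"
      using ij k x(1) nonneg
      by (intro mult_mono[OF power_mono[OF x(2)] power_mono[OF x(2)]]) auto
    then have "(c i ^ (j - k) * c j ^ (k - i)) * x ^ (i * (j - k) + j * (k - i))
        \<le> c k ^ ((j - k) + (k - i)) * x ^ (k * ((j - k) + (k - i)))"
      by (simp add: power_mult_distrib power_add power_mult[symmetric] add_mult_distrib2 mult_ac)
    then show "c i ^ (j - k) * c j ^ (k - i) \<le> c k ^ (j - i)"
      using x(1) unfolding exps by simp
  qed
next
  assume H: "\<forall>i j. i < k \<longrightarrow> k < j \<longrightarrow> j \<le> d \<longrightarrow> c i ^ (j - k) * c j ^ (k - i) \<le> c k ^ (j - i)"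
  define L where "L i = root (k - i) (c i / c k)" for i
  define U where "U j = root (j - k) (c k / c j)" for j
  define J where "J = {j. k < j \<and> j \<le> d \<and> 0 < c j}"
  have LU: "L i \<le> U j" if "i < k" "j \<in> J" for i j
  proof -
    have j: "k < j" "j \<le> d" "0 < c j"
      using that by (auto simp: J_def)
    have nn: "0 \<le> c i / c k" "0 \<le> c k / c j"
      using nonneg[of i] that(1) k j by auto
    have "j - i = (j - k) + (k - i)"
      using that(1) j by simp
    then have "c i ^ (j - k) * c j ^ (k - i) \<le> c k ^ (j - k) * c k ^ (k - i)"
      using H that(1) j by (metis power_add)
    then have "(c i / c k) ^ (j - k) \<le> (c k / c j) ^ (k - i)"
      using k j by (simp add: power_divide field_simps)
    moreover have "L i ^ ((k - i) * (j - k)) = (c i / c k) ^ (j - k)"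
      using that(1) nn by (simp add: L_def power_mult)
    moreover have "U j ^ ((k - i) * (j - k)) = (c k / c j) ^ (k - i)"
      using j nn by (subst mult.commute) (simp add: U_def power_mult)
    ultimately have "L i ^ ((k - i) * (j - k)) \<le> U j ^ ((k - i) * (j - k))"
      by (simp only:)
    moreover have "0 \<le> L i" "0 \<le> U j" "0 < (k - i) * (j - k)"
      using nn j that(1) by (auto simp: L_def U_def)
    ultimately show ?thesis
      by (simp only: power_mono_iff)
  qed
  have "\<exists>x>0. (\<forall>l\<in>L ` {..<k}. l \<le> x) \<and> (\<forall>u\<in>U ` J. x \<le> u)"
    using LU k by (intro ex_between_finite_sets) (auto simp: J_def U_def)
  then obtain x where x: "0 < x" "\<And>i. i < k \<Longrightarrow> L i \<le> x" "\<And>j. j \<in> J \<Longrightarrow> x \<le> U j"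
    by auto
  have "c i * x ^ i \<le> c k * x ^ k" if "i \<le> d" for i
  proof -
    have "0 \<le> c i"
      using that nonneg by simp
    then have "i < k \<or> i = k \<or> i \<in> J \<or> c i = 0"
      using that by (auto simp: J_def)
    then consider "i < k" | "i = k" | "i \<in> J" | "c i = 0"
      by blast
    then show ?thesis
    proof cases
      case 1
      have nn: "0 \<le> c i / c k"
        using nonneg[OF that] k by simp
      have "c i / c k = L i ^ (k - i)"
        using 1 nn by (simp add: L_def)
      also have "\<dots> \<le> x ^ (k - i)"
        using x(2)[OF 1] nn 1 by (intro power_mono) (auto simp: L_def)
      finally have "c i \<le> c k * x ^ (k - i)"
        using k by (simp add: field_simps)
      then have "c i * x ^ i \<le> c k * x ^ (k - i) * x ^ i"
        using x(1) by (intro mult_right_mono) auto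
      also have "\<dots> = c k * x ^ k"
        using 1 by (simp add: mult.assoc power_add[symmetric])
      finally show ?thesis .
    next
      case 3
      then have i: "k < i" "0 < c i"
        by (auto simp: J_def)
      have "x ^ (i - k) \<le> U i ^ (i - k)"
        using x 3 by (intro power_mono) auto
      also have "\<dots> = c k / c i"
        using i k by (simp add: U_def)
      finally have "c i * x ^ (i - k) \<le> c k"
        using i by (simp add: field_simps)
      then have "c i * x ^ (i - k) * x ^ k \<le> c k * x ^ k"
        using x(1) by (intro mult_right_mono) auto
      then show ?thesis
        using i by (simp add: mult.assoc power_add[symmetric])
    qed (use k x(1) in auto)
  qed
  then show "\<exists>x>0. \<forall>i\<le>d. c i * x ^ i \<le> c k * x ^ k"
    using x(1) by blast
qed

lemma closed_trop_index:
  assumes deg: "degree P = d" and "P \<noteq> 0"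
  shows "\<exists>C. closed C \<and> (\<forall>l. (\<forall>k\<le>d. 0 < l k) \<longrightarrow> (k \<in> trop_index_set l P \<longleftrightarrow> l \<in> C))"
proof (cases "k \<le> d \<and> coeff P k \<noteq> 0")
  case True
  define C where "C = {l. \<forall>i j. i < k \<longrightarrow> k < j \<longrightarrow> j \<le> d \<longrightarrow>
    (l i * \<bar>coeff P i\<bar>) ^ (j - k) * (l j * \<bar>coeff P j\<bar>) ^ (k - i) \<le> (l k * \<bar>coeff P k\<bar>) ^ (j - i)}"
  have "closed C"
    unfolding C_def
    by (intro closed_Collect_all closed_Collect_imp open_Collect_const closed_Collect_le
        continuous_intros continuous_on_product_coordinates)
  moreover have "k \<in> trop_index_set l P \<longleftrightarrow> l \<in> C" if l: "\<forall>k\<le>d. 0 < l k" for l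
  proof -
    have "k \<in> trop_index_set l P \<longleftrightarrow> (\<exists>x>0. \<forall>i\<le>d. l i * \<bar>coeff P i\<bar> * x ^ i \<le> l k * \<bar>coeff P k\<bar> * x ^ k)"
      using l True by (simp add: mem_trop_index_set_iff[OF deg])
    also have "\<dots> \<longleftrightarrow> l \<in> C"
      unfolding C_def mem_Collect_eq using l True by (intro ex_dominating_point_iff) auto
    finally show ?thesis .
  qed
  ultimately show ?thesis
    by blast
next
  case False
  then have "k \<notin> trop_index_set l P" if "\<forall>k\<le>d. 0 < l k" for l
    using coeff_trop_index_nonzero[OF deg _ \<open>P \<noteq> 0\<close>, of l k] trop_index_set_subset[OF deg, of l] that by blast
  then show ?thesis
    by (intro exI[of _ "{}"]) auto
qed

section \<open>Preservers relative to a class of polynomials\<close>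

text \<open>Root preservers for the polynomials of degree \<open>d\<close> in \<open>S\<close>. Both \<open>root_preservers\<close> and
  \<open>pos_root_preservers\<close> are instances, and everything below only needs \<open>(x + 1) ^ d \<in> S\<close>, or nothing
  at all, about \<open>S\<close>.\<close>

definition preservers :: "nat \<Rightarrow> real poly set \<Rightarrow> (nat \<Rightarrow> real) set" where
  "preservers d S = {l \<in> pos_orthant (Suc d).
     \<forall>P\<in>S. degree P = d \<longrightarrow> nonzero_real_roots P \<le> essential_roots l P}"

lemma mem_pos_orthant_iff: "l \<in> pos_orthant (Suc d) \<longleftrightarrow> (\<forall>k\<le>d. 0 < l k) \<and> (\<forall>k>d. l k = 0)"
  by (auto simp: pos_orthant_def topspace_Euclidean_space less_Suc_eq_le Suc_le_eq)

lemma preservers_mult_exp_concave: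
  assumes d: "1 \<le> d" and l: "l \<in> preservers d S" and c: "c \<in> concave_sequences d"
  shows "(\<lambda>k. l k * exp (c k)) \<in> preservers d S"
proof -
  have pos: "\<forall>k\<le>d. 0 < l k"
    using l by (auto simp: preservers_def mem_pos_orthant_iff)
  have "nonzero_real_roots P \<le> essential_roots (\<lambda>k. l k * exp (c k)) P" if "P \<in> S" "degree P = d" for P
  proof -
    have "P \<noteq> 0"
      using that d by auto
    have "nonzero_real_roots P \<le> essential_roots l P"
      using l that by (auto simp: preservers_def)
    also have "\<dots> \<le> essential_roots (\<lambda>k. l k * exp (c k)) P"
      unfolding essential_roots_eq_set_alternations[of l]
      using that pos c \<open>P \<noteq> 0\<close>
      by (intro set_alternations_trop_index_mono[of P d] trop_index_set_concave_mono[of P d l c])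
        (auto simp: concave_sequences_def)
    finally show ?thesis .
  qed
  then show ?thesis
    using l by (auto simp: preservers_def mem_pos_orthant_iff)
qed

section \<open>A strictly log-concave sequence that preserves all roots\<close>

lemma pcompose_power: "pcompose (p ^ n) q = pcompose p q ^ n" for p q :: "'a::comm_semiring_1 poly"
  by (induction n) (simp_all add: pcompose_mult pcompose_1)

lemma order_reflect:
  fixes P :: "real poly"
  assumes "P \<noteq> 0"
  shows "order x (pcompose P [:0, - 1:]) = order (- x) P"
proof -
  let ?r = "\<lambda>P :: real poly. pcompose P [:0, - 1:]"
  have le: "order (- x) P \<le> order x (?r P)" if "P \<noteq> 0" for x and P :: "real poly"
  proof -
    obtain q where "P = [:x, 1:] ^ order (- x) P * q"
      using order_1[of "- x" P] by (auto elim: dvdE)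
    then have "?r P = ?r [:x, 1:] ^ order (- x) P * ?r q"
      by (metis pcompose_mult pcompose_power)
    also have "?r [:x, 1:] = - [:- x, 1:]"
      by (simp add: pcompose_pCons)
    finally have "?r P = (- 1) ^ order (- x) P * [:- x, 1:] ^ order (- x) P * ?r q"
      by (simp only: power_minus[of "[:- x, 1:]"])
    then have "[:- x, 1:] ^ order (- x) P dvd ?r P"
      by (metis dvd_mult2 dvd_triv_right)
    moreover have "?r P \<noteq> 0"
      using that by (simp add: pcompose_eq_0_iff)
    ultimately show ?thesis
      by (simp add: order_divides)
  qed
  have "?r (?r P) = P"
    by (simp add: pcompose_assoc[symmetric] pcompose_pCons)
  then show ?thesis
    using le[of P x] le[of "?r P" "- x"] assms by (simp add: pcompose_eq_0_iff)
qed

lemma nonzero_real_roots_eq: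
  assumes "P \<noteq> 0"
  shows "nonzero_real_roots P = positive_roots P + positive_roots (pcompose P [:0, - 1:])"
proof -
  have nz: "pcompose P [:0, - 1:] \<noteq> 0"
    using assms by (simp add: pcompose_eq_0_iff)
  have "finite {x. poly P x = 0}"
    by (rule poly_roots_finite[OF assms])
  then have fin: "finite {x. 0 < x \<and> poly P x = 0}" "finite {x. x < 0 \<and> poly P x = 0}"
    by (auto elim: rev_finite_subset)
  have set: "set_mset {#x \<in># proots P. x \<noteq> 0#} = {x. 0 < x \<and> poly P x = 0} \<union> {x. x < 0 \<and> poly P x = 0}"
    using assms by auto
  have "nonzero_real_roots P = (\<Sum>x\<in>{x. 0 < x \<and> poly P x = 0} \<union> {x. x < 0 \<and> poly P x = 0}. order x P)"
    unfolding nonzero_real_roots_def size_multiset_overloaded_eq set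
    using assms by (intro sum.cong) auto
  also have "\<dots> = (\<Sum>x | 0 < x \<and> poly P x = 0. order x P) + (\<Sum>x | x < 0 \<and> poly P x = 0. order x P)"
    using fin by (intro sum.union_disjoint) auto
  also have "(\<Sum>x | x < 0 \<and> poly P x = 0. order x P) =
      (\<Sum>x | 0 < x \<and> poly (pcompose P [:0, - 1:]) x = 0. order x (pcompose P [:0, - 1:]))"
    by (rule sum.reindex_bij_witness[of _ uminus uminus]) (auto simp: order_reflect[OF assms] poly_pcompose)
  finally show ?thesis
    by (simp add: positive_roots_eq_sum_order assms nz)
qed

text \<open>The weights \<open>A ^ (- k\<^sup>2)\<close> with \<open>A = dominance d\<close>, extended by 0 to a point of the Euclidean space.\<close>

definition gaussian_weights :: "nat \<Rightarrow> nat \<Rightarrow> real" where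
  "gaussian_weights d k = (if k \<le> d then 1 / dominance d ^ (k ^ 2) else 0)"

text \<open>If \<open>k\<close> is not tropical for the Gaussian weights, its monomial is beaten by the factor \<open>A\<close> at every
  \<open>x > 0\<close>. At the point \<open>x * A ^ (2 * k)\<close> the weighted monomials are, up to a common factor, the
  original monomials at \<open>x\<close> multiplied by \<open>A ^ (- (i - k)\<^sup>2)\<close>.\<close>

lemma gaussian_weights_dominance:
  assumes deg: "degree P = d" and k: "k \<le> d" "k \<notin> trop_index_set (gaussian_weights d) P" and x: "0 < x"
  shows "\<exists>i\<le>d. dominance d * (\<bar>coeff P k\<bar> * x ^ k) \<le> \<bar>coeff P i\<bar> * x ^ i"
proof -
  define A where "A = dominance d"
  have A: "1 < A"
    by (simp add: A_def dominance_gt_1)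
  define y where "y = x * A ^ (2 * k)"
  have "0 < y"
    using x A by (simp add: y_def)
  moreover have "\<forall>k\<le>d. 0 < gaussian_weights d k"
    using A by (simp add: gaussian_weights_def A_def)
  ultimately obtain i where i: "i \<le> d"
    and less: "gaussian_weights d k * \<bar>coeff P k\<bar> * y ^ k < gaussian_weights d i * \<bar>coeff P i\<bar> * y ^ i"
    using k mem_trop_index_set_iff[OF deg, of "gaussian_weights d" k] by (meson not_le)
  have "i \<noteq> k"
    using less by auto
  have "2 * k * i + 1 \<le> k\<^sup>2 + i\<^sup>2"
  proof -
    have "0 < (int k - int i)\<^sup>2"
      using \<open>i \<noteq> k\<close> by simp
    then have "int (2 * k * i + 1) \<le> int (k\<^sup>2 + i\<^sup>2)"
      by (simp add: power2_eq_square algebra_simps)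
    then show ?thesis
      by (simp only: of_nat_le_iff)
  qed
  then have "A * A ^ (2 * k * i) \<le> A ^ (k\<^sup>2) * A ^ (i\<^sup>2)"
    unfolding power_add[symmetric] power_Suc[symmetric] using A by (intro power_increasing) auto
  then have "A * A ^ (2 * k * i) * (\<bar>coeff P k\<bar> * x ^ k) \<le> A ^ (k\<^sup>2) * A ^ (i\<^sup>2) * (\<bar>coeff P k\<bar> * x ^ k)"
    using x by (intro mult_right_mono) auto
  also have "\<dots> < A ^ (2 * k * i) * (\<bar>coeff P i\<bar> * x ^ i)"
  proof -
    have eq: "y ^ j = x ^ j * A ^ (2 * k * j)" for j
      by (simp add: y_def power_mult_distrib power_mult)
    have "A ^ (2 * k * k) = A ^ (k\<^sup>2) * A ^ (k\<^sup>2)"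
      by (simp add: power_add[symmetric] power2_eq_square mult_2[symmetric] mult.assoc)
    then show ?thesis
      using less A k i by (simp add: gaussian_weights_def A_def[symmetric] eq field_simps)
  qed
  finally have "A ^ (2 * k * i) * (A * (\<bar>coeff P k\<bar> * x ^ k)) \<le> A ^ (2 * k * i) * (\<bar>coeff P i\<bar> * x ^ i)"
    by (simp add: mult_ac)
  then have "A * (\<bar>coeff P k\<bar> * x ^ k) \<le> \<bar>coeff P i\<bar> * x ^ i"
    using A by (subst (asm) mult_le_cancel_left_pos) auto
  then show ?thesis
    using i by (auto simp: A_def)
qed

lemma gaussian_weights_preserver:
  assumes "1 \<le> d"
  shows "gaussian_weights d \<in> preservers d S"
proof -
  have pos: "\<forall>k\<le>d. 0 < gaussian_weights d k"
    using dominance_gt_1[of d] by (simp add: gaussian_weights_def)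
  have "nonzero_real_roots P \<le> essential_roots (gaussian_weights d) P" if deg: "degree P = d" for P
  proof -
    have P: "P \<noteq> 0"
      using deg assms by auto
    \<comment> \<open>The negative roots are the positive roots of \<open>P (- x)\<close>, whose tropical indices are the same.\<close>
    let ?I = "trop_index_set (gaussian_weights d) P" and ?R = "pcompose P [:0, - 1:]"
    have R: "degree ?R = d" "?R \<noteq> 0" "coeff ?R = (\<lambda>k. (- 1) ^ k * coeff P k)"
      using deg P by (auto simp: degree_pcompose pcompose_eq_0_iff coeff_pcompose_linear)
    have abs: "\<bar>(- 1) ^ k * coeff P k\<bar> = \<bar>coeff P k\<bar>" for k
      by (simp add: abs_mult)
    note I = trop_index_set_subset[OF deg pos] and nz = coeff_trop_index_nonzero[OF deg pos P]
      and dom = gaussian_weights_dominance[OF deg]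
    have "positive_roots P \<le> set_alternations (coeff P) ?I"
      using positive_roots_le_set_alternations[OF deg P I nz dom] by blast
    moreover have "positive_roots ?R \<le> set_alternations (coeff ?R) ?I"
    proof (rule positive_roots_le_set_alternations[OF R(1,2) I])
      show "coeff ?R k \<noteq> 0" if "k \<in> ?I" for k
        using nz[OF that] by (simp add: R)
      show "\<exists>i\<le>d. dominance d * (\<bar>coeff ?R k\<bar> * x ^ k) \<le> \<bar>coeff ?R i\<bar> * x ^ i"
        if "k \<le> d" "k \<notin> ?I" "0 < x" for k x
        using dom[OF that] by (simp add: R abs)
    qed
    ultimately show ?thesis
      by (simp add: nonzero_real_roots_eq[OF P] essential_roots_eq_set_alternations R(3))
  qed
  then show ?thesis
    using pos by (simp add: preservers_def mem_pos_orthant_iff gaussian_weights_def)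
qed

section \<open>Closedness and interior\<close>

lemma Euclidean_space_eq_top_of_set: "Euclidean_space n = top_of_set {x. \<forall>i\<ge>n. x i = 0}"
  by (simp add: Euclidean_space_def euclidean_product_topology)

text \<open>There are at least \<open>n\<close> essential roots iff some set of indices that already has \<open>n\<close> alternations
  consists of tropical indices. This is a finite union of closed conditions on the weights.\<close>

lemma closed_essential_roots_ge:
  assumes deg: "degree P = d" and P: "P \<noteq> 0"
  shows "\<exists>E. closed E \<and> (\<forall>l. (\<forall>k\<le>d. 0 < l k) \<longrightarrow> (n \<le> essential_roots l P \<longleftrightarrow> l \<in> E))"
proof -
  obtain C where C: "\<And>k. closed (C k)"
    "\<And>k l. \<forall>k\<le>d. 0 < l k \<Longrightarrow> k \<in> trop_index_set l P \<longleftrightarrow> l \<in> C k"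
    using closed_trop_index[OF assms] by metis
  define F where "F = {I \<in> Pow {..d}.
    n \<le> set_alternations (coeff P) I + set_alternations (\<lambda>k. (- 1) ^ k * coeff P k) I}"
  have "closed (\<Union>I\<in>F. \<Inter>k\<in>I. C k)"
    using C(1) by (intro closed_UN) (auto simp: F_def)
  moreover have "n \<le> essential_roots l P \<longleftrightarrow> l \<in> (\<Union>I\<in>F. \<Inter>k\<in>I. C k)" if l: "\<forall>k\<le>d. 0 < l k" for l
  proof
    assume "n \<le> essential_roots l P"
    then have "trop_index_set l P \<in> F"
      using trop_index_set_subset[OF deg l] by (auto simp: F_def essential_roots_eq_set_alternations)
    then show "l \<in> (\<Union>I\<in>F. \<Inter>k\<in>I. C k)"
      using C(2)[OF l] by blast
  next
    assume "l \<in> (\<Union>I\<in>F. \<Inter>k\<in>I. C k)"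
    then obtain I where I: "I \<in> F" "I \<subseteq> trop_index_set l P"
      using C(2)[OF l] by blast
    from I(1) have "n \<le> set_alternations (coeff P) I + set_alternations (\<lambda>k. (- 1) ^ k * coeff P k) I"
      by (simp add: F_def)
    also have "\<dots> \<le> essential_roots l P"
      by (rule set_alternations_trop_index_mono[OF deg P l I(2)])
    finally show "n \<le> essential_roots l P" .
  qed
  ultimately show ?thesis
    by blast
qed

lemma closedin_preservers:
  assumes "1 \<le> d"
  shows "closedin (subtopology (Euclidean_space (Suc d)) (pos_orthant (Suc d))) (preservers d S)"
proof -
  have "\<forall>P\<in>{P \<in> S. degree P = d}. \<exists>E. closed E \<and>
      (\<forall>l. (\<forall>k\<le>d. 0 < l k) \<longrightarrow> (nonzero_real_roots P \<le> essential_roots l P \<longleftrightarrow> l \<in> E))"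
    using assms by (auto intro!: closed_essential_roots_ge)
  from bchoice[OF this] obtain E where E: "\<forall>P\<in>{P \<in> S. degree P = d}. closed (E P) \<and>
      (\<forall>l. (\<forall>k\<le>d. 0 < l k) \<longrightarrow> (nonzero_real_roots P \<le> essential_roots l P \<longleftrightarrow> l \<in> E P))"
    by blast
  have "preservers d S = pos_orthant (Suc d) \<inter> (\<Inter>P\<in>{P \<in> S. degree P = d}. E P)"
    using E by (auto simp: preservers_def mem_pos_orthant_iff)
  moreover have "closed (\<Inter>P\<in>{P \<in> S. degree P = d}. E P)"
    using E by auto
  moreover have "subtopology (Euclidean_space (Suc d)) (pos_orthant (Suc d)) = top_of_set (pos_orthant (Suc d))"
    unfolding Euclidean_space_eq_top_of_set subtopology_subtopology
    by (rule arg_cong[of _ _ top_of_set]) (auto simp: pos_orthant_def topspace_Euclidean_space)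
  ultimately show ?thesis
    by (simp add: closedin_closed_Int)
qed

lemma mem_preservers_of_log_concave_ratio:
  assumes d: "1 \<le> d" and l: "l \<in> preservers d S" and m: "m \<in> pos_orthant (Suc d)"
    and ratio: "\<And>k. 1 \<le> k \<Longrightarrow> k \<le> d - 1 \<Longrightarrow>
      m (k - 1) * m (k + 1) * (l k)\<^sup>2 \<le> (m k)\<^sup>2 * (l (k - 1) * l (k + 1))"
  shows "m \<in> preservers d S"
proof -
  have pos: "0 < l k" "0 < m k" if "k \<le> d" for k
    using l m that by (auto simp: preservers_def mem_pos_orthant_iff)
  define c where "c k = (if k \<le> d then ln (m k / l k) else 0)" for k
  have "c (k - 1) + c (k + 1) \<le> 2 * c k" if k: "1 \<le> k" "k \<le> d - 1" for k
  proof -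
    have "k - 1 \<le> d" "k \<le> d" "k + 1 \<le> d"
      using k by auto
    note p = pos[OF this(1)] pos[OF this(2)] pos[OF this(3)]
    have "c (k - 1) + c (k + 1) = ln (m (k - 1) / l (k - 1) * (m (k + 1) / l (k + 1)))"
      using k p by (subst ln_mult) (auto simp: c_def)
    also have "\<dots> \<le> ln ((m k / l k)\<^sup>2)"
      using ratio[OF k] p by (subst ln_le_cancel_iff) (auto simp: field_simps power_divide)
    also have "\<dots> = 2 * c k"
      using k p by (subst ln_realpow) (auto simp: c_def)
    finally show ?thesis .
  qed
  then have "c \<in> concave_sequences d"
    by (auto simp: concave_sequences_def topspace_Euclidean_space c_def)
  from preservers_mult_exp_concave[OF d l this] have "(\<lambda>k. l k * exp (c k)) \<in> preservers d S" .
  also have "(\<lambda>k. l k * exp (c k)) = m"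
  proof
    show "l k * exp (c k) = m k" for k
      using pos[of k] l m by (cases "k \<le> d") (auto simp: c_def preservers_def mem_pos_orthant_iff)
  qed
  finally show ?thesis .
qed

text \<open>The sequences \<open>m\<close> for which \<open>m / l\<close> is strictly log-concave form a nonempty open set of preservers.\<close>

lemma full_dimensional_preservers:
  assumes d: "1 \<le> d" and l: "l \<in> preservers d S"
  shows "full_dimensional (Suc d) (preservers d S)"
proof -
  let ?W = "\<lambda>k. {m. m (k - 1) * m (k + 1) * (l k)\<^sup>2 < (m k)\<^sup>2 * (l (k - 1) * l (k + 1))}"
  define W where "W = (\<Inter>k\<in>{..d}. {m. 0 < m k}) \<inter> (\<Inter>k\<in>{1..d - 1}. ?W k)"
  define U where "U = {x. \<forall>i\<ge>Suc d. x i = 0} \<inter> W"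
  have "open W"
    unfolding W_def
    by (intro open_Int open_INT ballI finite_atMost finite_atLeastAtMost open_Collect_less
        continuous_intros continuous_on_product_coordinates)
  then have "openin (Euclidean_space (Suc d)) U"
    unfolding Euclidean_space_eq_top_of_set U_def by (rule openin_open_Int)
  moreover have "U \<subseteq> preservers d S"
  proof
    fix m assume "m \<in> U"
    then show "m \<in> preservers d S"
      by (intro mem_preservers_of_log_concave_ratio[OF d l])
        (auto simp: U_def W_def mem_pos_orthant_iff intro!: less_imp_le)
  qed
  moreover have "(\<lambda>k. l k * exp (- ((real k)\<^sup>2))) \<in> U"
  proof -
    have pos: "0 < l k" if "k \<le> d" for k
      using l that by (auto simp: preservers_def mem_pos_orthant_iff)
    have "l (k - 1) * exp (- ((real (k - 1))\<^sup>2)) * (l (k + 1) * exp (- ((real (k + 1))\<^sup>2))) * (l k)\<^sup>2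
        < (l k * exp (- ((real k)\<^sup>2)))\<^sup>2 * (l (k - 1) * l (k + 1))" if k: "1 \<le> k" "k \<le> d - 1" for k
    proof -
      have "exp (- ((real (k - 1))\<^sup>2)) * exp (- ((real (k + 1))\<^sup>2)) < (exp (- ((real k)\<^sup>2)))\<^sup>2"
        using k by (simp add: exp_add[symmetric] exp_of_nat_mult[symmetric] power2_eq_square of_nat_diff algebra_simps)
      moreover have "0 < l (k - 1) * l (k + 1) * (l k)\<^sup>2"
        using k by (intro mult_pos_pos zero_less_power pos) auto
      ultimately have "(exp (- ((real (k - 1))\<^sup>2)) * exp (- ((real (k + 1))\<^sup>2))) * (l (k - 1) * l (k + 1) * (l k)\<^sup>2)
          < (exp (- ((real k)\<^sup>2)))\<^sup>2 * (l (k - 1) * l (k + 1) * (l k)\<^sup>2)"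
        by (rule mult_strict_right_mono)
      then show ?thesis
        by (simp add: power_mult_distrib mult_ac)
    qed
    then show ?thesis
      using pos l by (auto simp: U_def W_def preservers_def mem_pos_orthant_iff)
  qed
  ultimately show ?thesis
    unfolding full_dimensional_def using interior_of_maximal by blast
qed

section \<open>The recession cone\<close>

lemma nonzero_real_roots_binomial: "nonzero_real_roots ([:1, 1:] ^ d) = d"
  unfolding nonzero_real_roots_def proots_power proots_linear_factor
  by (induction d) auto

text \<open>The polynomial \<open>(x + 1) ^ d\<close> has \<open>d\<close> nonzero real roots, counted with multiplicity, and positive
  coefficients. Each pair of consecutive
  tropical indices contributes at most one essential root, so all of \<open>0, \<dots>, d\<close> must be tropical,
  which makes the weighted binomial coefficients log-concave.\<close>

lemma preserver_binomial_log_concave: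
  assumes d: "1 \<le> d" and l: "l \<in> preservers d S" and S: "[:1, 1:] ^ d \<in> S"
    and k: "1 \<le> k" "k \<le> d - 1"
  shows "l (k - 1) * l (k + 1) * (real (d choose (k - 1)) * real (d choose (k + 1))) \<le> (l k * real (d choose k))\<^sup>2"
proof -
  define P :: "real poly" where "P = [:1, 1:] ^ d"
  have pos: "\<forall>k\<le>d. 0 < l k"
    using l by (auto simp: preservers_def mem_pos_orthant_iff)
  have deg: "degree P = d"
    unfolding P_def by (simp add: degree_power_eq)
  have coeff: "coeff P i = real (d choose i)" if "i \<le> d" for i
    using that by (simp add: P_def coeff_linear_poly_power)
  let ?I = "trop_index_set l P"
  have I: "?I \<subseteq> {..d}" "finite ?I"
    using trop_index_set_subset[OF deg pos] finite_subset by auto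
  have "d \<le> essential_roots l P"
    using l S deg nonzero_real_roots_binomial[of d] by (auto simp: preservers_def P_def)
  also have "\<dots> = set_alternations (\<lambda>k. (- 1) ^ k * coeff P k) ?I"
    using set_alternations_eq_0[of ?I "coeff P"] I coeff
    by (force simp: essential_roots_eq_set_alternations)
  finally have le: "d \<le> set_alternations (\<lambda>k. (- 1) ^ k * coeff P k) ?I" .
  have "?I \<noteq> {}"
    using le d by (auto simp: set_alternations_def)
  then have "d < card ?I"
    using le sign_alternations_less_length[of "map (\<lambda>k. sgn ((- 1) ^ k * coeff P k)) (sorted_list_of_set ?I)"] I
    by (simp add: set_alternations_def)
  then have "?I = {..d}"
    using I card_mono[OF _ I(1)] by (intro card_subset_eq) auto
  then have "k \<in> ?I"
    using k by auto
  then obtain x where x: "0 < x" "\<And>i. i \<le> d \<Longrightarrow> l i * \<bar>coeff P i\<bar> * x ^ i \<le> l k * \<bar>coeff P k\<bar> * x ^ k"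
    using mem_trop_index_set_iff[OF deg pos] by auto
  have bd: "k - 1 \<le> d" "k \<le> d" "k + 1 \<le> d"
    using k by auto
  define u where "u i = l i * real (d choose i)" for i
  have nn: "0 \<le> u i" if "i \<le> d" for i
    using pos that by (simp add: u_def less_imp_le)
  have ux: "u i * x ^ i \<le> u k * x ^ k" if "i \<le> d" for i
    using x(2)[OF that] that bd by (simp add: u_def coeff)
  have "(u (k - 1) * x ^ (k - 1)) * (u (k + 1) * x ^ (k + 1)) \<le> (u k * x ^ k) * (u k * x ^ k)"
    using nn bd x(1) by (intro mult_mono[OF ux ux]) auto
  moreover have "x ^ (k - 1) * x ^ (k + 1) = x ^ k * x ^ k"
    using k by (cases k) (auto simp: mult_ac)
  moreover have "(u (k - 1) * x ^ (k - 1)) * (u (k + 1) * x ^ (k + 1))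
      = (u (k - 1) * u (k + 1)) * (x ^ (k - 1) * x ^ (k + 1))"
    by (simp only: mult_ac)
  ultimately have "(u (k - 1) * u (k + 1)) * (x ^ k * x ^ k) \<le> (u k)\<^sup>2 * (x ^ k * x ^ k)"
    by (simp only: power2_eq_square mult_ac)
  then have "u (k - 1) * u (k + 1) \<le> (u k)\<^sup>2"
    using x(1) by (subst (asm) mult_le_cancel_right_pos) auto
  then show ?thesis
    by (simp add: u_def mult_ac)
qed

lemma mem_Ln_image_preservers:
  "y \<in> Ln_image (Suc d) (preservers d S) \<longleftrightarrow>
     (\<forall>k>d. y k = 0) \<and> (\<lambda>k. if k \<le> d then exp (y k) else 0) \<in> preservers d S"
proof
  assume "y \<in> Ln_image (Suc d) (preservers d S)"
  then obtain l where l: "l \<in> preservers d S" and y: "y = (\<lambda>i. if i < Suc d then ln (l i) else 0)"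
    by (auto simp: Ln_image_def)
  have "(\<lambda>k. if k \<le> d then exp (y k) else 0) = l"
    using l by (auto simp: y preservers_def mem_pos_orthant_iff)
  then show "(\<forall>k>d. y k = 0) \<and> (\<lambda>k. if k \<le> d then exp (y k) else 0) \<in> preservers d S"
    using l by (simp add: y)
next
  assume y: "(\<forall>k>d. y k = 0) \<and> (\<lambda>k. if k \<le> d then exp (y k) else 0) \<in> preservers d S"
  then show "y \<in> Ln_image (Suc d) (preservers d S)"
    unfolding Ln_image_def by (intro image_eqI[OF _ conjunct2[OF y]]) auto
qed

lemma recession_cone_preservers:
  assumes d: "1 \<le> d" and S: "[:1, 1:] ^ d \<in> S"
  shows "recession_cone (Suc d) (Ln_image (Suc d) (preservers d S)) = concave_sequences d"
    (is "recession_cone _ ?X = _")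
proof (rule antisym)
  show "concave_sequences d \<subseteq> recession_cone (Suc d) ?X"
  proof -
    have "t * c (k - 1) + t * c (k + 1) \<le> 2 * (t * c k)"
      if "c (k - 1) + c (k + 1) \<le> 2 * c k" "0 \<le> t" for t :: real and c :: "nat \<Rightarrow> real" and k
      using mult_left_mono[OF that] by (simp add: algebra_simps)
    then have "is_cone (Suc d) (concave_sequences d)"
      unfolding is_cone_def by (auto simp: concave_sequences_def topspace_Euclidean_space)
    moreover have "(\<lambda>i. x i + c i) \<in> ?X" if x: "x \<in> ?X" and c: "c \<in> concave_sequences d" for x c
    proof -
      have "(\<lambda>k. (if k \<le> d then exp (x k) else 0) * exp (c k)) \<in> preservers d S"
        using x c by (intro preservers_mult_exp_concave[OF d]) (auto simp: mem_Ln_image_preservers)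
      also have "(\<lambda>k. (if k \<le> d then exp (x k) else 0) * exp (c k)) = (\<lambda>k. if k \<le> d then exp (x k + c k) else 0)"
        by (auto simp: exp_add)
      finally show ?thesis
        using x c by (auto simp: mem_Ln_image_preservers concave_sequences_def topspace_Euclidean_space)
    qed
    ultimately show ?thesis
      unfolding recession_cone_eq_Union by blast
  qed
next
  show "recession_cone (Suc d) ?X \<subseteq> concave_sequences d"
  proof
    fix c assume "c \<in> recession_cone (Suc d) ?X"
    then obtain C where C: "is_cone (Suc d) C" "\<forall>x\<in>?X. \<forall>c\<in>C. (\<lambda>i. x i + c i) \<in> ?X" "c \<in> C"
      unfolding recession_cone_eq_Union by blast
    define y where "y k = (if k \<le> d then ln (gaussian_weights d k) else 0)" for k
    have "(\<lambda>k. if k \<le> d then exp (y k) else 0) = gaussian_weights d"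
      using gaussian_weights_preserver[OF d, of S] by (auto simp: y_def preservers_def mem_pos_orthant_iff)
    then have y: "y \<in> ?X"
      using gaussian_weights_preserver[OF d, of S] by (simp add: mem_Ln_image_preservers) (simp add: y_def)
    have "c (k - 1) + c (k + 1) \<le> 2 * c k" if k: "1 \<le> k" "k \<le> d - 1" for k
    proof (rule ccontr)
      assume "\<not> c (k - 1) + c (k + 1) \<le> 2 * c k"
      then have e: "0 < c (k - 1) + c (k + 1) - 2 * c k"
        by simp
      have bd: "k - 1 \<le> d" "k \<le> d" "k + 1 \<le> d"
        using k by auto
      define a where "a = exp (y (k - 1) + y (k + 1) - 2 * y k) * (real (d choose (k - 1)) * real (d choose (k + 1)))"
      have "0 < a"
        using bd by (simp add: a_def)
      have bound: "a * exp (t * (c (k - 1) + c (k + 1) - 2 * c k)) \<le> (real (d choose k))\<^sup>2" if "0 \<le> t" for t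
      proof -
        define z where "z i = y i + t * c i" for i
        have "(\<lambda>i. t * c i) \<in> C"
          using C that by (auto simp: is_cone_def)
        with bspec[OF C(2) y] have "z \<in> ?X"
          unfolding z_def by (rule bspec)
        then have "(\<lambda>k. if k \<le> d then exp (z k) else 0) \<in> preservers d S"
          by (simp add: mem_Ln_image_preservers)
        from preserver_binomial_log_concave[OF d this S k]
        have "exp (z (k - 1) + z (k + 1)) * (real (d choose (k - 1)) * real (d choose (k + 1)))
            \<le> exp (2 * z k) * (real (d choose k))\<^sup>2"
          using bd by (simp add: exp_add power_mult_distrib exp_double)
        then have "exp (- (2 * z k)) * (exp (z (k - 1) + z (k + 1)) * (real (d choose (k - 1)) * real (d choose (k + 1))))
            \<le> exp (- (2 * z k)) * (exp (2 * z k) * (real (d choose k))\<^sup>2)"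
          by (intro mult_left_mono) auto
        then have "exp (- (2 * z k) + (z (k - 1) + z (k + 1))) * (real (d choose (k - 1)) * real (d choose (k + 1)))
            \<le> (real (d choose k))\<^sup>2"
          by (simp add: mult.assoc[symmetric] exp_add[symmetric])
        also have "- (2 * z k) + (z (k - 1) + z (k + 1)) =
            (y (k - 1) + y (k + 1) - 2 * y k) + t * (c (k - 1) + c (k + 1) - 2 * c k)"
          by (simp add: z_def algebra_simps)
        finally show ?thesis
          unfolding exp_add a_def by (simp only: mult_ac)
      qed
      \<comment> \<open>For this \<open>t\<close> the linear minorant \<open>1 + u \<le> exp u\<close> already contradicts \<open>bound\<close>.\<close>
      define t where "t = (real (d choose k))\<^sup>2 / (a * (c (k - 1) + c (k + 1) - 2 * c k))"
      have "0 \<le> t"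
        using \<open>0 < a\<close> e by (simp add: t_def)
      have "(real (d choose k))\<^sup>2 < a * (1 + t * (c (k - 1) + c (k + 1) - 2 * c k))"
        using \<open>0 < a\<close> e by (simp add: t_def divide_simps)
      also have "\<dots> \<le> a * exp (t * (c (k - 1) + c (k + 1) - 2 * c k))"
        using \<open>0 < a\<close> exp_ge_add_one_self by (intro mult_left_mono) auto
      finally show False
        using bound[OF \<open>0 \<le> t\<close>] by simp
    qed
    then show "c \<in> concave_sequences d"
      using C by (auto simp: concave_sequences_def is_cone_def)
  qed
qed

theorem theorem9:
  fixes d :: nat
  assumes "1 \<le> d"
  shows "(root_preservers d \<noteq> {} \<and>
          closedin (subtopology (Euclidean_space (Suc d)) (pos_orthant (Suc d))) (root_preservers d) \<and>
          full_dimensional (Suc d) (root_preservers d) \<and>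
          recession_cone (Suc d) (Ln_image (Suc d) (root_preservers d)) = concave_sequences d) \<and>
         (pos_root_preservers d \<noteq> {} \<and>
          closedin (subtopology (Euclidean_space (Suc d)) (pos_orthant (Suc d))) (pos_root_preservers d) \<and>
          full_dimensional (Suc d) (pos_root_preservers d) \<and>
          recession_cone (Suc d) (Ln_image (Suc d) (pos_root_preservers d)) = concave_sequences d)"
proof -
  have main: "preservers d S \<noteq> {} \<and>
      closedin (subtopology (Euclidean_space (Suc d)) (pos_orthant (Suc d))) (preservers d S) \<and>
      full_dimensional (Suc d) (preservers d S) \<and>
      recession_cone (Suc d) (Ln_image (Suc d) (preservers d S)) = concave_sequences d"
    if "[:1, 1:] ^ d \<in> S" for S
    using gaussian_weights_preserver[OF assms] closedin_preservers[OF assms]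
      full_dimensional_preservers[OF assms] recession_cone_preservers[OF assms that] by blast
  have "root_preservers d = preservers d UNIV"
    by (simp add: root_preservers_def preservers_def)
  moreover have "pos_root_preservers d = preservers d {P. \<forall>k\<le>d. 0 < coeff P k}"
    by (auto simp: pos_root_preservers_def preservers_def)
  moreover have "[:1, 1:] ^ d \<in> {P :: real poly. \<forall>k\<le>d. 0 < coeff P k}"
    by (simp add: coeff_linear_poly_power)
  ultimately show ?thesis
    using main by simp
qed

end
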